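(* Let $G$ be a Hausdorff topological group with identity $e$. Then $G$ is $\omega$-narrow and a $q$-space if and only if for each open neighborhood $O$ of $e$ in $G$ there is a countably compact invariant subgroup $H$ of $G$ which is of countable character in $G$, such that $H\subseteq O$, the canonical quotient mapping $p:G\rightarrow G/H$ is quasi-perfect, and the quotient group $G/H$ is separable and metrizable.
   Context: All topological groups and spaces are assumed to be Hausdorff. "Invariant subgroup" means normal subgroup. For a subgroup $H$ of $G$, $G/H$ is the space of left cosets with the quotient topology, and $p:G\to G/H$ is the canonical quotient mapping. A topological group $G$ is $\omega$-narrow if for every open neighbourhood $V$ of the identity there is a countable subset $A$ of $G$ such that $AV=G$. A point $x$ of a space $X$ is a $q$-point if there is a sequence $\{U_n:n\in\omega\}$ of open neighborhoods of $x$ in $X$ such that every sequence $\{x_n\}_{n\in\omega}$ of points of $X$ with $x_n\in U_n$ for each $n\in\omega$ has a point of accumulation in $X$ (a point each of whose neighborhoods contains $x_n$ for infinitely many $n$). A space is a $q$-space if each of its points is a $q$-point. A subset $A$ of a space $X$ is of countable character in $X$ if there is a countable family $\{U_n:n\in\omega\}$ of open neighborhoods of $A$ (open sets containing $A$) such that each open neighborhood $U$ of $A$ contains some $U_n$. A set is countably compact if, as a subspace, every countable open cover of it has a finite subcover. A continuous mapping $f:X\to Y$ is quasi-perfect if $f$ is closed and $f^{-1}(y)$ is countably compact for each $y\in Y$. *)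

theory Defs
  imports "HOL-Analysis.Analysis" "HOL-Algebra.Left_Coset"
begin

locale topological_group = group G for G (structure) +
  fixes T :: "'a topology"
  assumes topspace_eq_carrier: "topspace T = carrier G"
    and continuous_mult: "continuous_map (prod_topology T T) T (\<lambda>(x, y). x \<otimes> y)"
    and continuous_inv: "continuous_map T T (\<lambda>x. inv x)"

definition omega_narrow :: "('a, 'b) monoid_scheme \<Rightarrow> 'a topology \<Rightarrow> bool" where
  "omega_narrow G T \<longleftrightarrow>
     (\<forall>V. openin T V \<and> \<one>\<^bsub>G\<^esub> \<in> V \<longrightarrow>
        (\<exists>A. countable A \<and> A \<subseteq> carrier G \<and> A <#>\<^bsub>G\<^esub> V = carrier G))"

definition accumulation_point_of_seq :: "'a topology \<Rightarrow> (nat \<Rightarrow> 'a) \<Rightarrow> 'a \<Rightarrow> bool" where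
  "accumulation_point_of_seq X s y \<longleftrightarrow>
     y \<in> topspace X \<and> (\<forall>V. openin X V \<and> y \<in> V \<longrightarrow> infinite {n. s n \<in> V})"

definition q_point :: "'a topology \<Rightarrow> 'a \<Rightarrow> bool" where
  "q_point X x \<longleftrightarrow>
     (\<exists>U :: nat \<Rightarrow> 'a set. (\<forall>n. openin X (U n) \<and> x \<in> U n) \<and>
        (\<forall>s. (\<forall>n. s n \<in> U n) \<longrightarrow> (\<exists>y. accumulation_point_of_seq X s y)))"

definition q_space :: "'a topology \<Rightarrow> bool" where
  "q_space X \<longleftrightarrow> (\<forall>x \<in> topspace X. q_point X x)"

definition countable_character_in :: "'a topology \<Rightarrow> 'a set \<Rightarrow> bool" where
  "countable_character_in X A \<longleftrightarrow>
     (\<exists>U :: nat \<Rightarrow> 'a set. (\<forall>n. openin X (U n) \<and> A \<subseteq> U n) \<and>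
        (\<forall>V. openin X V \<and> A \<subseteq> V \<longrightarrow> (\<exists>n. U n \<subseteq> V)))"

definition countably_compact_space :: "'a topology \<Rightarrow> bool" where
  "countably_compact_space X \<longleftrightarrow>
     (\<forall>\<U>. countable \<U> \<and> (\<forall>U \<in> \<U>. openin X U) \<and> \<Union>\<U> = topspace X \<longrightarrow>
        (\<exists>\<F>. finite \<F> \<and> \<F> \<subseteq> \<U> \<and> \<Union>\<F> = topspace X))"

definition countably_compactin :: "'a topology \<Rightarrow> 'a set \<Rightarrow> bool" where
  "countably_compactin X S \<longleftrightarrow>
     S \<subseteq> topspace X \<and> countably_compact_space (subtopology X S)"

definition quasi_perfect_map :: "'a topology \<Rightarrow> 'b topology \<Rightarrow> ('a \<Rightarrow> 'b) \<Rightarrow> bool" where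
  "quasi_perfect_map X Y f \<longleftrightarrow>
     continuous_map X Y f \<and> closed_map X Y f \<and>
     (\<forall>y \<in> topspace Y. countably_compactin X {x \<in> topspace X. f x = y})"

definition quotient_topology :: "'a topology \<Rightarrow> ('a \<Rightarrow> 'b) \<Rightarrow> 'b topology" where
  "quotient_topology X f =
     topology (\<lambda>U. U \<subseteq> f ` topspace X \<and> openin X {x \<in> topspace X. f x \<in> U})"

lemma openin_quotient_topology:
  "openin (quotient_topology X f) U \<longleftrightarrow>
     U \<subseteq> f ` topspace X \<and> openin X {x \<in> topspace X. f x \<in> U}"
proof -
  have "istopology (\<lambda>U. U \<subseteq> f ` topspace X \<and> openin X {x \<in> topspace X. f x \<in> U})"
    unfolding istopology_def
  proof (intro conjI allI impI)
    fix S U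
    assume S: "S \<subseteq> f ` topspace X \<and> openin X {x \<in> topspace X. f x \<in> S}"
      and U: "U \<subseteq> f ` topspace X \<and> openin X {x \<in> topspace X. f x \<in> U}"
    show "S \<inter> U \<subseteq> f ` topspace X"
      using S by blast
    have "{x \<in> topspace X. f x \<in> S \<inter> U} =
        {x \<in> topspace X. f x \<in> S} \<inter> {x \<in> topspace X. f x \<in> U}"
      by blast
    then show "openin X {x \<in> topspace X. f x \<in> S \<inter> U}"
      using S U by (simp add: openin_Int)
  next
    fix \<K>
    assume K: "\<forall>K\<in>\<K>. K \<subseteq> f ` topspace X \<and> openin X {x \<in> topspace X. f x \<in> K}"
    show "\<Union>\<K> \<subseteq> f ` topspace X"
      using K by blast
    have "{x \<in> topspace X. f x \<in> \<Union>\<K>} = (\<Union>K\<in>\<K>. {x \<in> topspace X. f x \<in> K})"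
      by blast
    then show "openin X {x \<in> topspace X. f x \<in> \<Union>\<K>}"
      using K by auto
  qed
  then show ?thesis
    by (simp add: quotient_topology_def topology_inverse')
qed

lemma topspace_quotient_topology [simp]:
  "topspace (quotient_topology X f) = f ` topspace X"
proof
  show "topspace (quotient_topology X f) \<subseteq> f ` topspace X"
    using openin_topspace [of "quotient_topology X f"] unfolding openin_quotient_topology by simp
  have "{x \<in> topspace X. f x \<in> f ` topspace X} = topspace X"
    by blast
  then have "openin (quotient_topology X f) (f ` topspace X)"
    by (simp add: openin_quotient_topology)
  then show "f ` topspace X \<subseteq> topspace (quotient_topology X f)"
    by (rule openin_subset)
qed

lemma quotient_map_quotient_topology: "quotient_map X (quotient_topology X f) f"
  by (auto simp: quotient_map_def openin_quotient_topology)

definition coset_map :: "('a, 'b) monoid_scheme \<Rightarrow> 'a set \<Rightarrow> 'a \<Rightarrow> 'a set" where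
  "coset_map G H = (\<lambda>x. x <#\<^bsub>G\<^esub> H)"

definition coset_space :: "('a, 'b) monoid_scheme \<Rightarrow> 'a topology \<Rightarrow> 'a set \<Rightarrow> 'a set topology" where
  "coset_space G T H = quotient_topology T (coset_map G H)"

lemma (in topological_group) topspace_coset_space:
  "topspace (coset_space G T H) = carrier (G LMod H)"
  by (auto simp: coset_space_def coset_map_def LFactGroup_def LCOSETS_def topspace_eq_carrier)

text \<open>For a normal subgroup the left and right cosets agree, so the underlying set is also that of
  the library's quotient group \<open>G Mod H\<close>, which is built from right cosets.\<close>

lemma (in topological_group) topspace_coset_space_normal:
  assumes "H \<lhd> G"
  shows "topspace (coset_space G T H) = carrier (G Mod H)"
  using normal.coset_eq [OF assms]
  by (auto simp: coset_space_def coset_map_def FactGroup_def RCOSETS_def topspace_eq_carrier)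

end

theory Submission
  imports Defs
begin

text \<open>
  In an \<open>\<omega>\<close>-narrow group every neighbourhood of the identity has countably many neighbourhoods
  such that each conjugation maps one of them into it. Hence the neighbourhoods witnessing that the
  identity is a \<open>q\<close>-point can be refined to a decreasing sequence \<open>W n\<close> inside the given set that is
  cofinally closed under \<open>(a, b) \<mapsto> a b\<^sup>-\<^sup>1\<close> and under conjugation, so its intersection \<open>H\<close> is a
  normal subgroup. Every sequence with \<open>s n \<in> W n\<close> accumulates, necessarily at a point of \<open>H\<close>;
  therefore \<open>H\<close> is countably compact, the \<open>W n\<close> form a base at \<open>H\<close>, and the quotient map is closed.
  The images of the translates of the \<open>W n\<close> give a countable base of the regular \<open>T\<^sub>1\<close> quotient, which
  is thus metrizable by Urysohn's theorem.

  Conversely, closedness of the quotient map yields a saturated open \<open>P\<close> with \<open>H \<subseteq> P \<subseteq> O\<close>, and lifting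
  a countable dense subset of the quotient gives countably many translates of \<open>O\<close> covering the group.
  Countable compactness and countable character of one \<open>H\<close> already make the group a \<open>q\<close>-space.
\<close>

section \<open>Metrization of regular second countable spaces\<close>

text \<open>Urysohn's embedding argument: regularity and the Lindelof property give normality, and
  countably many Urysohn functions then embed the space into a countable power of the real
  line.\<close>

lemma regular_second_countable_imp_metrizable_space:
  assumes reg: "regular_space X" and sc: "second_countable X" and t1: "t1_space X"
  shows "metrizable_space X"
proof -
  obtain B where B: "countable B" "\<And>V. V \<in> B \<Longrightarrow> openin X V"
    and base: "\<And>U x. openin X U \<Longrightarrow> x \<in> U \<Longrightarrow> \<exists>V\<in>B. x \<in> V \<and> V \<subseteq> U"
    using sc unfolding second_countable_def by metis
  have normal: "normal_space X"
    by (simp add: reg regular_Lindelof_imp_normal_space sc second_countable_imp_Lindelof_space)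
  \<comment> \<open>Each pair of base sets in \<open>I\<close> has a closed set inside an open one,
    so Urysohn's lemma supplies one function per pair. Countability of \<open>I\<close> is what
    makes the product metrizable.\<close>
  define I where "I = {(U, V). U \<in> B \<and> V \<in> B \<and> X closure_of U \<subseteq> V}"
  have "I \<subseteq> B \<times> B"
    by (auto simp: I_def)
  then have "countable I"
    using countable_subset [OF _ countable_SIGMA [OF B(1) B(1)]] by blast
  have "\<exists>f. continuous_map X euclideanreal f \<and> f ` (X closure_of fst i) \<subseteq> {0}
      \<and> f ` (topspace X - snd i) \<subseteq> {1}" if "i \<in> I" for i
  proof (rule Urysohn_lemma_alt [OF normal])
    show "closedin X (X closure_of fst i)" "closedin X (topspace X - snd i)"
      using that B(2) by (auto simp: I_def)
    show "disjnt (X closure_of fst i) (topspace X - snd i)"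
      using that by (auto simp: I_def disjnt_iff)
  qed blast
  then obtain f where f: "\<And>i. i \<in> I \<Longrightarrow> continuous_map X euclideanreal (f i)"
      and f0: "\<And>i. i \<in> I \<Longrightarrow> f i ` (X closure_of fst i) \<subseteq> {0}"
      and f1: "\<And>i. i \<in> I \<Longrightarrow> f i ` (topspace X - snd i) \<subseteq> {1}"
    by metis
  \<comment> \<open>The functions separate points from closed sets: shrink U to a base set V, then
    by regularity to a base set V' around x whose closure stays in V, and take the function of the
    pair (V', V).\<close>
  have sep: "\<exists>i\<in>I. f i x = 0 \<and> (\<forall>y \<in> topspace X - U. f i y = 1)"
    if xU: "openin X U" "x \<in> U" for x U
  proof -
    obtain V where V: "V \<in> B" "x \<in> V" "V \<subseteq> U"
      using base [OF xU] by auto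
    obtain N C where N: "openin X N" "closedin X C" "x \<in> N" "N \<subseteq> C" "C \<subseteq> V"
      using reg V(2) B(2) [OF V(1)]
      unfolding neighbourhood_base_of_closedin [symmetric] neighbourhood_base_of
      by metis
    obtain V' where V': "V' \<in> B" "x \<in> V'" "V' \<subseteq> N"
      using base [OF N(1,3)] by auto
    have "X closure_of V' \<subseteq> V"
      by (meson N V' closure_of_minimal order_trans)
    then have i: "(V', V) \<in> I"
      using V V' by (simp add: I_def)
    have "x \<in> X closure_of V'"
      using V'(2) closure_of_subset [OF openin_subset [OF B(2) [OF V'(1)]]] by auto
    then show ?thesis
      using f0 [OF i] f1 [OF i] V(3) by (intro bexI [OF _ i]) auto
  qed
  define Y where "Y = product_topology (\<lambda>_. euclideanreal) I"
  define F where "F = (\<lambda>x. \<lambda>i\<in>I. f i x)"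
  have contF: "continuous_map X Y F"
    using f by (auto simp: Y_def F_def continuous_map_componentwise)
  have injF: "inj_on F (topspace X)"
  proof (rule inj_onI, rule ccontr)
    fix x y assume xy: "x \<in> topspace X" "y \<in> topspace X" "F x = F y" "x \<noteq> y"
    then obtain U where "openin X U" "x \<in> U" "y \<notin> U"
      using t1 unfolding t1_space_def by metis
    then obtain i where "i \<in> I" "f i x = 0" "f i y = 1"
      using sep xy by blast
    then show False
      using fun_cong [OF xy(3), of i] by (simp add: F_def)
  qed
  have openF: "open_map X (subtopology Y (F ` topspace X)) F"
    unfolding open_map_def
  proof (intro allI impI)
    fix U assume U: "openin X U"
    have "\<exists>S. openin (subtopology Y (F ` topspace X)) S \<and> F x \<in> S \<and> S \<subseteq> F ` U"
      if x: "x \<in> U" for x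
    proof -
      obtain i where i: "i \<in> I" "f i x = 0" "\<forall>y \<in> topspace X - U. f i y = 1"
        using sep [OF U x] by blast
      define S where "S = {z \<in> topspace Y. z i \<in> {..<1}}"
      have "continuous_map Y euclideanreal (\<lambda>z. z i)"
        unfolding Y_def using i(1) by (rule continuous_map_product_projection)
      then have "openin Y S"
        unfolding S_def by (rule openin_continuous_map_preimage) simp
      moreover have "x \<in> topspace X"
        using U x openin_subset by blast
      then have "F x \<in> S"
        using i contF by (auto simp: S_def F_def continuous_map_def)
      moreover have "S \<inter> F ` topspace X \<subseteq> F ` U"
      proof clarify
        fix y assume y: "F y \<in> S" "y \<in> topspace X"
        then have "f i y < 1"
          using i(1) by (simp add: S_def F_def)
        then have "y \<in> U"
          using i(3) y(2) by force
        then show "F y \<in> F ` U"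
          by blast
      qed
      ultimately show ?thesis
        using \<open>x \<in> topspace X\<close>
        by (intro exI [of _ "S \<inter> F ` topspace X"]) (auto simp: openin_subtopology)
    qed
    then show "openin (subtopology Y (F ` topspace X)) (F ` U)"
      by (subst openin_subopen) blast
  qed
  have "homeomorphic_map X (subtopology Y (F ` topspace X)) F"
  proof (rule bijective_open_imp_homeomorphic_map)
    show "F ` topspace X = topspace (subtopology Y (F ` topspace X))"
      using contF by (auto simp: continuous_map_def)
  qed (use contF injF openF in \<open>auto simp: continuous_map_in_subtopology\<close>)
  then have "X homeomorphic_space subtopology Y (F ` topspace X)"
    by (rule homeomorphic_map_imp_homeomorphic_space)
  moreover have "metrizable_space Y"
    unfolding Y_def metrizable_space_product_topology
    using \<open>countable I\<close> by (auto simp: metrizable_space_euclidean)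
  ultimately show ?thesis
    using homeomorphic_metrizable_space metrizable_space_subtopology by blast
qed

section \<open>Countable compactness via accumulation points\<close>

text \<open>If an enumerated cover had no finite subcover, one could pick \<open>s n\<close> in S
  outside its first n + 1 members. An accumulation point in S would lie in some \<open>U k\<close>,
  which only terms of index below k can meet.\<close>

lemma countably_compactin_if_accumulation_points:
  assumes S: "S \<subseteq> topspace X"
    and acc: "\<And>s. (\<And>n. s n \<in> S) \<Longrightarrow> \<exists>y\<in>S. accumulation_point_of_seq X s y"
  shows "countably_compactin X S"
  unfolding countably_compactin_def countably_compact_space_def
proof (intro conjI allI impI S)
  fix \<U>
  assume \<U>: "countable \<U> \<and> (\<forall>U\<in>\<U>. openin (subtopology X S) U) \<and> \<Union>\<U> = topspace (subtopology X S)"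
  have top: "topspace (subtopology X S) = S"
    using S by auto
  show "\<exists>\<F>. finite \<F> \<and> \<F> \<subseteq> \<U> \<and> \<Union>\<F> = topspace (subtopology X S)"
  proof (rule ccontr)
    assume no: "\<not> ?thesis"
    then have "\<U> \<noteq> {}"
      using \<U> by (metis empty_subsetI finite.emptyI)
    define U where "U = from_nat_into \<U>"
    have U: "range U = \<U>"
      using \<U> \<open>\<U> \<noteq> {}\<close> by (simp add: U_def range_from_nat_into)
    have "\<exists>x. x \<in> S \<and> x \<notin> (\<Union>i\<le>n. U i)" for n
    proof -
      have fin: "finite (U ` {..n})" "U ` {..n} \<subseteq> \<U>"
        using U by auto
      then have "\<Union>(U ` {..n}) \<noteq> S"
        using no top by metis
      moreover have "\<Union>(U ` {..n}) \<subseteq> S"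
        using fin \<U> top by blast
      ultimately show ?thesis
        by blast
    qed
    then obtain s where s: "\<And>n. s n \<in> S" "\<And>n. s n \<notin> (\<Union>i\<le>n. U i)"
      by metis
    obtain y where y: "y \<in> S" "accumulation_point_of_seq X s y"
      using acc s(1) by blast
    then obtain k where k: "y \<in> U k"
      using U \<U> top by blast
    obtain V where V: "openin X V" "U k = V \<inter> S"
      using U \<U> unfolding openin_subtopology by blast
    have "{n. s n \<in> V} \<subseteq> {..<k}"
      using s V by force
    then have "finite {n. s n \<in> V}"
      using finite_subset by blast
    then show False
      using y V k unfolding accumulation_point_of_seq_def by blast
  qed
qed

text \<open>Were the intersection to miss S, the complements of the \<open>F n\<close> would cover
  S. Since F decreases, a finite subcover would make a single \<open>F k\<close> miss S.\<close>

lemma countably_compactin_decseq_closed: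
  assumes cc: "countably_compactin X S" and dec: "decseq F"
    and cl: "\<And>n. closedin X (F n)" and ne: "\<And>n. F n \<inter> S \<noteq> {}"
  shows "(\<Inter>n. F n) \<inter> S \<noteq> {}"
proof
  assume empty: "(\<Inter>n. F n) \<inter> S = {}"
  define \<U> where "\<U> = range (\<lambda>n. S - F n)"
  have S: "S \<subseteq> topspace X"
    using cc by (simp add: countably_compactin_def)
  have "openin (subtopology X S) (S - F n)" for n
    unfolding openin_subtopology
    using S cl [of n] by (intro exI [of _ "topspace X - F n"]) auto
  moreover have "\<Union>\<U> = topspace (subtopology X S)"
    using S empty by (auto simp: \<U>_def)
  moreover have "countable \<U>"
    by (simp add: \<U>_def)
  moreover have "countable \<U> \<and> (\<forall>U\<in>\<U>. openin (subtopology X S) U)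
      \<and> \<Union>\<U> = topspace (subtopology X S) \<longrightarrow>
      (\<exists>\<F>. finite \<F> \<and> \<F> \<subseteq> \<U> \<and> \<Union>\<F> = topspace (subtopology X S))"
    using cc unfolding countably_compactin_def countably_compact_space_def by (elim conjE allE)
  moreover have "\<forall>U\<in>\<U>. openin (subtopology X S) U"
    using calculation(1) by (auto simp: \<U>_def)
  ultimately obtain \<F> where \<F>: "finite \<F>" "\<F> \<subseteq> \<U>" "\<Union>\<F> = topspace (subtopology X S)"
    by meson
  then obtain N where N: "finite N" "\<F> = (\<lambda>n. S - F n) ` N"
    unfolding \<U>_def by (meson finite_subset_image)
  obtain k where k: "\<forall>n\<in>N. n \<le> k"
    using N(1) finite_nat_set_iff_bounded_le by auto
  obtain x where x: "x \<in> F k" "x \<in> S"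
    using ne by blast
  then obtain n where "n \<in> N" "x \<notin> F n"
    using \<F>(3) N(2) S by auto
  then show False
    using x k decseqD [OF dec, of n k] by blast
qed

text \<open>The closures of the tails of s form a decreasing sequence of closed sets. None misses S,
  since otherwise its complement would contain some \<open>U n\<close> and hence late terms of s. A
  common point in S is an accumulation point.\<close>

lemma accumulation_point_near_countably_compactin:
  assumes cc: "countably_compactin X S"
    and U: "\<And>V. openin X V \<Longrightarrow> S \<subseteq> V \<Longrightarrow> \<exists>n. U n \<subseteq> V"
    and s: "\<And>n. s n \<in> topspace X" "\<And>i n. i \<le> n \<Longrightarrow> s n \<in> U i"
  shows "\<exists>y. accumulation_point_of_seq X s y"
proof -
  define F where "F k = X closure_of s ` {k..}" for k
  have S: "S \<subseteq> topspace X"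
    using cc by (simp add: countably_compactin_def)
  have sF: "s n \<in> F k" if "k \<le> n" for k n
  proof -
    have "s ` {k..} \<subseteq> F k"
      unfolding F_def using s(1) by (intro closure_of_subset) blast
    then show ?thesis
      using that by auto
  qed
  have "(\<Inter>k. F k) \<inter> S \<noteq> {}"
  proof (rule countably_compactin_decseq_closed [OF cc])
    show "decseq F"
      unfolding F_def decseq_def by (intro allI impI closure_of_mono image_mono) auto
    show "closedin X (F k)" for k
      by (simp add: F_def)
    show "F k \<inter> S \<noteq> {}" for k
    proof
      assume "F k \<inter> S = {}"
      then have "S \<subseteq> topspace X - F k"
        using S by blast
      moreover have "openin X (topspace X - F k)"
        unfolding F_def by (intro openin_diff openin_topspace closedin_closure_of)
      ultimately obtain n where n: "U n \<subseteq> topspace X - F k"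
        using U by metis
      \<comment> \<open>The index \<open>max k n\<close> is large enough both for the tail starting
        at k and for membership in \<open>U n\<close>.\<close>
      have "s (max k n) \<in> U n" "s (max k n) \<in> F k"
        using s(2) sF by simp_all
      then show False
        using n by blast
    qed
  qed
  then obtain y where y: "\<And>k. y \<in> F k" "y \<in> S"
    by blast
  have "infinite {n. s n \<in> V}" if V: "openin X V" "y \<in> V" for V
    unfolding infinite_nat_iff_unbounded_le
  proof
    fix k
    obtain z where "z \<in> s ` {k..}" "z \<in> V"
      using y(1) [of k] V unfolding F_def in_closure_of by blast
    then show "\<exists>n\<ge>k. n \<in> {n. s n \<in> V}"
      by auto
  qed
  then show ?thesis
    using y(2) S unfolding accumulation_point_of_seq_def by blast
qed

text \<open>Iterate F from A and take the union of the stages. The invariant P is carried along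
  because F is known to have countable values only where P holds.\<close>

lemma countable_closure:
  fixes F :: "'c \<Rightarrow> 'c set"
  assumes "countable A" and "\<And>a. P a \<Longrightarrow> countable (F a)"
    and "\<And>a. a \<in> A \<Longrightarrow> P a" and "\<And>a b. P a \<Longrightarrow> b \<in> F a \<Longrightarrow> P b"
  obtains B where "countable B" "A \<subseteq> B" "\<And>b. b \<in> B \<Longrightarrow> P b" "\<And>b. b \<in> B \<Longrightarrow> F b \<subseteq> B"
proof -
  define C where "C = rec_nat A (\<lambda>_ S. \<Union>(F ` S))"
  have C: "C 0 = A" "C (Suc n) = \<Union>(F ` C n)" for n
    by (auto simp: C_def)
  have "countable (C n) \<and> (\<forall>a\<in>C n. P a)" for n
    by (induction n) (use assms in \<open>auto simp: C\<close>)
  then have "countable (\<Union>n. C n)" "\<And>b. b \<in> (\<Union>n. C n) \<Longrightarrow> P b"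
    by auto
  moreover have "A \<subseteq> (\<Union>n. C n)"
    using C(1) by blast
  moreover have "F b \<subseteq> (\<Union>n. C n)" if "b \<in> (\<Union>n. C n)" for b
    using that C(2) by blast
  ultimately show thesis
    using that by blast
qed

section \<open>Neighbourhoods of the identity\<close>

context topological_group
begin

lemma openin_subset_carrier: "openin T U \<Longrightarrow> U \<subseteq> carrier G"
  using openin_subset topspace_eq_carrier by metis

lemma continuous_map_group_mult:
  assumes "continuous_map X T f" "continuous_map X T g"
  shows "continuous_map X T (\<lambda>x. f x \<otimes> g x)"
  using continuous_map_compose [OF continuous_map_pairedI [OF assms] continuous_mult]
  by (simp add: o_def)

lemma continuous_map_group_inv:
  assumes "continuous_map X T f"
  shows "continuous_map X T (\<lambda>x. inv (f x))"
  using continuous_map_compose [OF assms continuous_inv] by (simp add: o_def)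

text \<open>Continuity at the pair of identities gives an open box inside the preimage of U;
  intersecting its two sides yields one neighbourhood that serves both arguments.\<close>

lemma nbhd_one_of_continuous_pair:
  assumes f: "continuous_map (prod_topology T T) T (\<lambda>p. f (fst p) (snd p))"
    and U: "openin T U" "f \<one> \<one> \<in> U"
  obtains V where "openin T V" "\<one> \<in> V" "\<And>a b. a \<in> V \<Longrightarrow> b \<in> V \<Longrightarrow> f a b \<in> U"
proof -
  define P where "P = {p \<in> topspace (prod_topology T T). f (fst p) (snd p) \<in> U}"
  have "openin (prod_topology T T) P"
    unfolding P_def using f U(1) by (rule openin_continuous_map_preimage)
  moreover have "(\<one>, \<one>) \<in> P"
    using U by (simp add: P_def topspace_eq_carrier)
  ultimately obtain V V' where V: "openin T V" "openin T V'" "\<one> \<in> V" "\<one> \<in> V'" "V \<times> V' \<subseteq> P"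
    unfolding openin_prod_topology_alt by meson
  show thesis
  proof
    show "openin T (V \<inter> V')"
      using V by blast
  qed (use V in \<open>auto simp: P_def\<close>)
qed

lemma nbhd_one_div:
  assumes "openin T U" "\<one> \<in> U"
  obtains V where "openin T V" "\<one> \<in> V" "\<And>a b. a \<in> V \<Longrightarrow> b \<in> V \<Longrightarrow> a \<otimes> inv b \<in> U"
  by (rule nbhd_one_of_continuous_pair [of "\<lambda>a b. a \<otimes> inv b" U])
    (use assms in \<open>auto intro!: continuous_map_group_mult continuous_map_group_inv
      continuous_map_fst continuous_map_snd\<close>)

lemma nbhd_one_inner:
  assumes "openin T U" "\<one> \<in> U"
  obtains V where "openin T V" "\<one> \<in> V" "\<And>a b. a \<in> V \<Longrightarrow> b \<in> V \<Longrightarrow> inv a \<otimes> b \<otimes> a \<in> U"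
  by (rule nbhd_one_of_continuous_pair [of "\<lambda>a b. inv a \<otimes> b \<otimes> a" U])
    (use assms in \<open>auto intro!: continuous_map_group_mult continuous_map_group_inv
      continuous_map_fst continuous_map_snd\<close>)

text \<open>The two-sided form covers left translates, right translates and conjugates at
  once.\<close>

lemma openin_translates:
  assumes "openin T U" "x \<in> carrier G" "z \<in> carrier G"
  shows "openin T {y \<in> carrier G. x \<otimes> y \<otimes> z \<in> U}"
proof -
  have "continuous_map T T (\<lambda>y. x \<otimes> y \<otimes> z)"
    using assms by (intro continuous_map_group_mult) (auto simp: topspace_eq_carrier)
  then show ?thesis
    using openin_continuous_map_preimage [OF _ assms(1)] topspace_eq_carrier by fastforce
qed

lemma mem_l_coset_iff:
  assumes "x \<in> carrier G" "U \<subseteq> carrier G"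
  shows "y \<in> x <# U \<longleftrightarrow> y \<in> carrier G \<and> inv x \<otimes> y \<in> U"
proof
  assume "y \<in> x <# U"
  then show "y \<in> carrier G \<and> inv x \<otimes> y \<in> U"
    using assms by (auto simp: l_coset_def m_assoc [symmetric] subset_iff)
next
  assume y: "y \<in> carrier G \<and> inv x \<otimes> y \<in> U"
  then have "y = x \<otimes> (inv x \<otimes> y)"
    using assms by (simp add: m_assoc [symmetric])
  then show "y \<in> x <# U"
    using y unfolding l_coset_def by blast
qed

lemma openin_l_coset:
  assumes "openin T U" "x \<in> carrier G"
  shows "openin T (x <# U)"
proof -
  have "x <# U = {y \<in> carrier G. inv x \<otimes> y \<otimes> \<one> \<in> U}"
    using assms by (auto simp: mem_l_coset_iff openin_subset_carrier)
  then show ?thesis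
    using openin_translates [of U "inv x" \<one>] assms by simp
qed

lemma accumulation_point_translate:
  assumes x: "x \<in> carrier G" and s: "\<And>n. s n \<in> carrier G"
    and y: "accumulation_point_of_seq T (\<lambda>n. inv x \<otimes> s n) y"
  shows "accumulation_point_of_seq T s (x \<otimes> y)"
  unfolding accumulation_point_of_seq_def
proof (intro conjI allI impI)
  have yG: "y \<in> carrier G"
    using y by (simp add: accumulation_point_of_seq_def topspace_eq_carrier)
  then show "x \<otimes> y \<in> topspace T"
    using x by (simp add: topspace_eq_carrier)
  fix V assume V: "openin T V \<and> x \<otimes> y \<in> V"
  have "y \<in> inv x <# V"
    using V x yG by (simp add: mem_l_coset_iff openin_subset_carrier)
  then have "infinite {n. inv x \<otimes> s n \<in> inv x <# V}"
    using y V x openin_l_coset unfolding accumulation_point_of_seq_def by simp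
  moreover have "inv x \<otimes> s n \<in> inv x <# V \<Longrightarrow> s n \<in> V" for n
    using x s V by (simp add: mem_l_coset_iff openin_subset_carrier m_assoc [symmetric])
  ultimately show "infinite {n. s n \<in> V}"
    by (metis (mono_tags, lifting) mem_Collect_eq rev_finite_subset subsetI)
qed

text \<open>Choose W whose mutual conjugates lie in U and a countable A with A W = G. If the inverse
  of x is a w, conjugation by x is conjugation by the inverse of a followed by conjugation by the
  inverse of w. So the preimage of W under the first conjugation works, and only countably many a
  occur.\<close>

lemma omega_narrow_imp_omega_balanced:
  assumes narrow: "omega_narrow G T" and U: "openin T U" "\<one> \<in> U"
  obtains g :: "nat \<Rightarrow> 'a set" where "\<And>n. openin T (g n)" "\<And>n. \<one> \<in> g n"
    "\<And>x. x \<in> carrier G \<Longrightarrow> \<exists>n. \<forall>b\<in>g n. x \<otimes> b \<otimes> inv x \<in> U"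
proof -
  obtain W where W: "openin T W" "\<one> \<in> W" "\<And>a b. a \<in> W \<Longrightarrow> b \<in> W \<Longrightarrow> inv a \<otimes> b \<otimes> a \<in> U"
    using nbhd_one_inner [OF U] by metis
  obtain A where A: "countable A" "A \<subseteq> carrier G" "A <#> W = carrier G"
    using narrow W(1,2) unfolding omega_narrow_def by metis
  have "A \<noteq> {}"
    using A(3) one_closed by (auto simp: set_mult_def)
  then have rA: "range (from_nat_into A) = A"
    using A(1) by (simp add: range_from_nat_into)
  define g where "g n = {b \<in> carrier G. inv (from_nat_into A n) \<otimes> b \<otimes> from_nat_into A n \<in> W}" for n
  have rG: "from_nat_into A n \<in> carrier G" for n
    using rA A(2) by blast
  show thesis
  proof
    show "openin T (g n)" for n
      unfolding g_def using rG W(1) by (intro openin_translates) auto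
    show "\<one> \<in> g n" for n
      using rG W(2) by (simp add: g_def)
    fix x assume x: "x \<in> carrier G"
    then have "inv x \<in> A <#> W"
      using A(3) by simp
    then obtain a w where aw: "a \<in> A" "w \<in> W" "inv x = a \<otimes> w"
      unfolding set_mult_def by blast
    have awG: "a \<in> carrier G" "w \<in> carrier G"
      using aw A(2) W(1) openin_subset_carrier by auto
    have x_eq: "x = inv w \<otimes> inv a"
      using x awG aw(3) by (metis inv_inv inv_mult_group)
    obtain n where n: "a = from_nat_into A n"
      using aw(1) rA by blast
    have "x \<otimes> b \<otimes> inv x \<in> U" if "b \<in> g n" for b
    proof -
      have b: "b \<in> carrier G" "inv a \<otimes> b \<otimes> a \<in> W"
        using that by (auto simp: g_def n)
      have "x \<otimes> b \<otimes> inv x = inv w \<otimes> (inv a \<otimes> b \<otimes> a) \<otimes> w"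
        using b awG by (simp add: aw(3)) (simp add: x_eq m_assoc)
      then show ?thesis
        using W(3) [OF aw(2) b(2)] by simp
    qed
    then show "\<exists>n. \<forall>b\<in>g n. x \<otimes> b \<otimes> inv x \<in> U"
      by blast
  qed
qed

end

section \<open>Normal subgroups as intersections of neighbourhood sequences\<close>

text \<open>Division and conjugation are controlled only up to passing to another index, which
  suffices for the intersection to be a normal subgroup. The index in \<open>conj_W\<close> may
  depend on x, so no single member has to absorb all conjugations.\<close>

locale normal_nbhd_sequence = topological_group +
  fixes W :: "nat \<Rightarrow> 'a set"
  assumes open_W: "openin T (W n)"
    and one_W: "\<one> \<in> W n"
    and decseq_W: "decseq W"
    and div_W: "\<exists>m. \<forall>a\<in>W m. \<forall>b\<in>W m. a \<otimes> inv b \<in> W n"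
    and conj_W: "x \<in> carrier G \<Longrightarrow> \<exists>m. \<forall>a\<in>W m. x \<otimes> a \<otimes> inv x \<in> W n"

context topological_group
begin

text \<open>Close the given neighbourhoods under chosen refinements for division (f) and for
  conjugation (g). The closure is countable, and finite intersections along an enumeration of it
  form the sequence.\<close>

lemma omega_narrow_imp_normal_nbhd_sequence:
  assumes narrow: "omega_narrow G T"
    and U: "\<And>n. openin T (U n)" "\<And>n. \<one> \<in> U n"
  obtains W where "normal_nbhd_sequence G T W" "\<And>n::nat. W n \<subseteq> U n"
proof -
  define P where "P V \<longleftrightarrow> openin T V \<and> \<one> \<in> V" for V
  have "\<exists>f. P f \<and> (\<forall>a\<in>f. \<forall>b\<in>f. a \<otimes> inv b \<in> V)" if "P V" for V
    using nbhd_one_div [of V] that unfolding P_def by metis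
  then obtain f where f: "\<And>V. P V \<Longrightarrow> P (f V)"
      "\<And>V a b. P V \<Longrightarrow> a \<in> f V \<Longrightarrow> b \<in> f V \<Longrightarrow> a \<otimes> inv b \<in> V"
    by metis
  have "\<exists>g::nat \<Rightarrow> 'a set. (\<forall>n. P (g n)) \<and> (\<forall>x\<in>carrier G. \<exists>n. \<forall>b\<in>g n. x \<otimes> b \<otimes> inv x \<in> V)"
    if "P V" for V
    using omega_narrow_imp_omega_balanced [OF narrow, of V] that unfolding P_def by metis
  then obtain g where g: "\<And>V n. P V \<Longrightarrow> P (g V (n::nat))"
      "\<And>V x. P V \<Longrightarrow> x \<in> carrier G \<Longrightarrow> \<exists>n. \<forall>b\<in>g V n. x \<otimes> b \<otimes> inv x \<in> V"
    by metis
  obtain B where B: "countable B" "range U \<subseteq> B" "\<And>V. V \<in> B \<Longrightarrow> P V"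
    "\<And>V. V \<in> B \<Longrightarrow> insert (f V) (range (g V)) \<subseteq> B"
  proof (rule countable_closure [of "range U" P "\<lambda>V. insert (f V) (range (g V))"])
    show "\<And>V. V \<in> range U \<Longrightarrow> P V"
      using U by (auto simp: P_def)
    show "\<And>V V'. P V \<Longrightarrow> V' \<in> insert (f V) (range (g V)) \<Longrightarrow> P V'"
      using f(1) g(1) by blast
  qed (auto intro: that)
  define v where "v = from_nat_into B"
  have v: "range v = B"
    unfolding v_def using B(1,2) by (intro range_from_nat_into) auto
  \<comment> \<open>The factors \<open>U i\<close> ensure that \<open>W n\<close> lies in
    \<open>U n\<close>; the factors \<open>v i\<close> bring W eventually inside each member of
    B.\<close>
  define W where "W n = (\<Inter>i\<le>n. v i \<inter> U i)" for n
  have vP: "P (v i)" for i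
    using v B(3) by blast
  have dec: "decseq W"
    unfolding W_def decseq_def by fastforce
  have refine: "\<exists>k. \<forall>n. k \<le> n \<longrightarrow> W n \<subseteq> V" if V: "V \<in> B" for V
  proof -
    obtain k where "V = v k"
      using V v by blast
    then show ?thesis
      by (auto simp: W_def)
  qed
  \<comment> \<open>The relation R treats division and conjugation uniformly. Its second premise
    says that R passes through the finite intersection defining \<open>W n\<close>, so only finitely
    many members of B have to be refined.\<close>
  have refine_W: "\<exists>m. \<forall>a\<in>W m. \<forall>b\<in>W m. R a b (W n)"
    if step: "\<And>V. V \<in> B \<Longrightarrow> \<exists>V'\<in>B. \<forall>a\<in>V'. \<forall>b\<in>V'. R a b V"
      and R: "\<And>a b n. R a b (W n) \<longleftrightarrow> (\<forall>i\<le>n. R a b (v i) \<and> R a b (U i))"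
    for R and n
  proof -
    have "\<exists>k. \<forall>m\<ge>k. \<forall>a\<in>W m. \<forall>b\<in>W m. R a b V" if V: "V \<in> B" for V
    proof -
      obtain V' where V': "V' \<in> B" "\<forall>a\<in>V'. \<forall>b\<in>V'. R a b V"
        using step [OF V] by auto
      then show ?thesis
        using refine [OF V'(1)] by blast
    qed
    then obtain k where k: "\<And>V m. V \<in> B \<Longrightarrow> k V \<le> m \<Longrightarrow> \<forall>a\<in>W m. \<forall>b\<in>W m. R a b V"
      by metis
    \<comment> \<open>The sum serves only as a common upper bound of the finitely many
      thresholds.\<close>
    define m where "m = (\<Sum>i\<le>n. k (v i) + k (U i))"
    have "k (v i) \<le> m" "k (U i) \<le> m" if "i \<le> n" for i
      using member_le_sum [of i "{..n}" "\<lambda>i. k (v i) + k (U i)"] that by (auto simp: m_def)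
    then have "\<forall>a\<in>W m. \<forall>b\<in>W m. R a b (W n)"
      unfolding R using k v B(2) by (metis rangeI subsetD)
    then show ?thesis
      by blast
  qed
  show thesis
  proof
    show "W n \<subseteq> U n" for n
      by (auto simp: W_def)
    show "normal_nbhd_sequence G T W"
    proof
      show "openin T (W n)" for n
        unfolding W_def using vP U by (intro openin_INT2) (auto simp: P_def)
      show "\<one> \<in> W n" for n
        using vP U by (auto simp: W_def P_def)
      show "decseq W"
        by (rule dec)
      show "\<exists>m. \<forall>a\<in>W m. \<forall>b\<in>W m. a \<otimes> inv b \<in> W n" for n
      proof (rule refine_W)
        fix V assume V: "V \<in> B"
        show "\<exists>V'\<in>B. \<forall>a\<in>V'. \<forall>b\<in>V'. a \<otimes> inv b \<in> V"
          using B(4) [OF V] f(2) [OF B(3) [OF V]] by (intro bexI [of _ "f V"]) auto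
      qed (auto simp: W_def)
      show "\<exists>m. \<forall>a\<in>W m. x \<otimes> a \<otimes> inv x \<in> W n" if x: "x \<in> carrier G" for x n
      proof -
        \<comment> \<open>The variable b is a dummy that gives the claim the binary shape of
          \<open>refine_W\<close>.\<close>
        have "\<exists>m. \<forall>a\<in>W m. \<forall>b\<in>W m. x \<otimes> a \<otimes> inv x \<in> W n"
        proof (rule refine_W)
          fix V assume V: "V \<in> B"
          obtain n where "\<forall>b\<in>g V n. x \<otimes> b \<otimes> inv x \<in> V"
            using g(2) [OF B(3) [OF V] x] by blast
          then show "\<exists>V'\<in>B. \<forall>a\<in>V'. \<forall>b\<in>V'. x \<otimes> a \<otimes> inv x \<in> V"
            using B(4) [OF V] by (intro bexI [of _ "g V n"]) auto
        qed (auto simp: W_def)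
        then show ?thesis
          by blast
      qed
    qed
  qed
qed

end

section \<open>The coset map\<close>

context topological_group
begin

lemma coset_map_eq_iff:
  assumes "subgroup H G" "x \<in> carrier G" "y \<in> carrier G"
  shows "coset_map G H x = coset_map G H y \<longleftrightarrow> inv x \<otimes> y \<in> H"
proof -
  have "H \<subseteq> carrier G"
    using assms(1) by (rule subgroup.subset)
  then have "inv x \<otimes> y \<in> H \<longleftrightarrow> y \<in> x <# H"
    using assms by (simp add: mem_l_coset_iff)
  also have "\<dots> \<longleftrightarrow> x <# H = y <# H"
    using assms l_repr_independence lcos_self by metis
  finally show ?thesis
    by (simp add: coset_map_def)
qed

lemma continuous_map_coset_map: "continuous_map T (coset_space G T H) (coset_map G H)"
  unfolding coset_space_def
  by (simp add: quotient_imp_continuous_map quotient_map_quotient_topology)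

text \<open>The saturation of U is the union over h in H of the sets of all x with x h in U, each a
  right translate of U.\<close>

lemma open_map_coset_map:
  assumes H: "subgroup H G"
  shows "open_map T (coset_space G T H) (coset_map G H)"
  unfolding open_map_def
proof (intro allI impI)
  fix U assume U: "openin T U"
  have UG: "U \<subseteq> carrier G"
    using U by (rule openin_subset_carrier)
  have HG: "H \<subseteq> carrier G"
    using H by (rule subgroup.subset)
  have "{x \<in> topspace T. coset_map G H x \<in> coset_map G H ` U}
      = (\<Union>h\<in>H. {x \<in> carrier G. \<one> \<otimes> x \<otimes> h \<in> U})" (is "?L = ?R")
  proof (intro Set.set_eqI iffI)
    fix x assume "x \<in> ?L"
    then obtain u where u: "u \<in> U" "x \<in> carrier G" "coset_map G H x = coset_map G H u"
      by (auto simp: topspace_eq_carrier)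
    then have "inv x \<otimes> u \<in> H"
      using H UG coset_map_eq_iff by blast
    moreover have "\<one> \<otimes> x \<otimes> (inv x \<otimes> u) = u"
      using u UG by (simp add: m_assoc [symmetric] subset_iff)
    ultimately show "x \<in> ?R"
      using u by force
  next
    fix x assume "x \<in> ?R"
    then obtain h where h: "h \<in> H" "x \<in> carrier G" "x \<otimes> h \<in> U"
      by auto
    then have "inv x \<otimes> (x \<otimes> h) \<in> H"
      using HG by (simp add: m_assoc [symmetric] subset_iff)
    then have "coset_map G H x = coset_map G H (x \<otimes> h)"
      using coset_map_eq_iff [OF H] h HG by blast
    then show "x \<in> ?L"
      using h by (auto simp: topspace_eq_carrier)
  qed
  moreover have "openin T ?R"
    using U HG by (intro openin_Union) (auto intro!: openin_translates)
  ultimately show "openin (coset_space G T H) (coset_map G H ` U)"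
    using UG by (auto simp: coset_space_def openin_quotient_topology topspace_eq_carrier)
qed

end

section \<open>From quotients to the group\<close>

context topological_group
begin

text \<open>Closedness of the quotient map makes the largest saturated subset P of U open, and P
  contains the identity because H lies in U. Representatives of a countable dense set then give the
  translates: density finds a suitable coset, and saturation of P lets its chosen representative be
  used.\<close>

lemma omega_narrow_at_if_separable_quotient:
  assumes H: "H \<lhd> G" and HU: "H \<subseteq> U" and U: "openin T U"
    and closed: "closed_map T (coset_space G T H) (coset_map G H)"
    and separable: "separable_space (coset_space G T H)"
  obtains A where "countable A" "A \<subseteq> carrier G" "A <#> U = carrier G"
proof -
  define p where "p = coset_map G H"
  define Y where "Y = coset_space G T H"
  have sub: "subgroup H G"
    using H by (rule normal_imp_subgroup)
  note p_eq = coset_map_eq_iff [OF sub, folded p_def]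
  have UG: "U \<subseteq> carrier G"
    using U by (rule openin_subset_carrier)
  have topY: "topspace Y = p ` carrier G"
    by (simp add: Y_def p_def coset_space_def topspace_eq_carrier)
  \<comment> \<open>P consists of the points whose coset does not meet the complement of U.\<close>
  define P where "P = {x \<in> topspace T. p x \<in> topspace Y - p ` (topspace T - U)}"
  have openP: "openin T P"
    unfolding P_def
  proof (rule openin_continuous_map_preimage)
    show "continuous_map T Y p"
      unfolding Y_def p_def by (rule continuous_map_coset_map)
    show "openin Y (topspace Y - p ` (topspace T - U))"
      using closed U unfolding Y_def p_def closed_map_def by blast
  qed
  have PU: "P \<subseteq> U"
    by (auto simp: P_def)
  have one_P: "\<one> \<in> P"
  proof -
    have "p \<one> \<notin> p ` (carrier G - U)"
    proof
      assume "p \<one> \<in> p ` (carrier G - U)"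
      then obtain f where f: "f \<in> carrier G" "f \<notin> U" "p \<one> = p f"
        by blast
      then have "inv \<one> \<otimes> f \<in> H"
        using p_eq [of \<one> f] by simp
      then show False
        using f(1,2) HU by auto
    qed
    then show ?thesis
      by (simp add: P_def topY topspace_eq_carrier)
  qed
  obtain C where C: "countable C" "C \<subseteq> topspace Y" "Y closure_of C = topspace Y"
    using separable unfolding separable_space_def Y_def by blast
  have "\<exists>a. a \<in> carrier G \<and> p a = c" if "c \<in> C" for c
    using C(2) that unfolding topY by auto
  then obtain r where r: "\<And>c. c \<in> C \<Longrightarrow> r c \<in> carrier G" "\<And>c. c \<in> C \<Longrightarrow> p (r c) = c"
    by metis
  have "x \<in> r ` C <#> U" if x: "x \<in> carrier G" for x
  proof -
    define N where "N = {y \<in> topspace T. inv y \<otimes> x \<in> P}"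
    have "continuous_map T T (\<lambda>y. inv y \<otimes> x)"
      using x by (intro continuous_map_group_mult continuous_map_group_inv)
        (auto simp: topspace_eq_carrier)
    then have "openin T N"
      unfolding N_def using openP by (rule openin_continuous_map_preimage)
    then have "openin Y (p ` N)"
      using open_map_coset_map [OF sub] unfolding open_map_def Y_def p_def by blast
    moreover have "p x \<in> p ` N"
      using x one_P by (auto simp: N_def topspace_eq_carrier)
    moreover have "p x \<in> Y closure_of C"
      using x by (simp add: C(3) topY)
    ultimately obtain c where c: "c \<in> C" "c \<in> p ` N"
      unfolding in_closure_of by blast
    then obtain y where y: "y \<in> carrier G" "inv y \<otimes> x \<in> P" "p y = p (r c)"
      using r(2) by (auto simp: N_def topspace_eq_carrier)
    define a where "a = r c"
    have a: "a \<in> carrier G" "inv y \<otimes> a \<in> H"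
      using r(1) c(1) y p_eq by (auto simp: a_def)
    \<comment> \<open>Conjugating the inverse of y times a first by y and then by the inverse of x
      shows that \<open>inv a \<otimes> x\<close> and \<open>inv y \<otimes> x\<close> lie in one
      coset, so membership in P passes from the latter to the former.\<close>
    have "inv x \<otimes> (y \<otimes> (inv y \<otimes> a) \<otimes> inv y) \<otimes> inv (inv x) \<in> H"
      using normal_invE(2) [OF H] a x y(1) by (meson inv_closed)
    then have "inv (inv a \<otimes> x) \<otimes> (inv y \<otimes> x) \<in> H"
      using a x y(1) by (simp add: inv_mult_group m_assoc [symmetric])
    then have "p (inv a \<otimes> x) = p (inv y \<otimes> x)"
      using p_eq a x y(1) by simp
    then have "inv a \<otimes> x \<in> P"
      using y(2) a(1) x by (auto simp: P_def topspace_eq_carrier)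
    then have "inv a \<otimes> x \<in> U"
      using PU by blast
    moreover have "x = a \<otimes> (inv a \<otimes> x)"
      using a(1) x by (simp add: m_assoc [symmetric])
    ultimately show ?thesis
      using c(1) unfolding set_mult_def a_def by blast
  qed
  moreover have "r ` C <#> U \<subseteq> carrier G"
    using r(1) UG by (intro set_mult_closed) auto
  ultimately show thesis
    using C(1) r(1) by (intro that [of "r ` C"]) auto
qed

text \<open>A countable base of neighbourhoods of H witnesses the q-point condition at the identity,
  and left translation carries it to every point.\<close>

lemma q_space_if_countably_compact_countable_character:
  assumes cc: "countably_compactin T H" and char: "countable_character_in T H"
    and one: "\<one> \<in> H"
  shows "q_space T"
  unfolding q_space_def q_point_def
proof
  fix x assume "x \<in> topspace T"
  then have x: "x \<in> carrier G"
    by (simp add: topspace_eq_carrier)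
  obtain U :: "nat \<Rightarrow> 'a set" where U: "\<And>n. openin T (U n)" "\<And>n. H \<subseteq> U n"
    and base: "\<And>V. openin T V \<Longrightarrow> H \<subseteq> V \<Longrightarrow> \<exists>n. U n \<subseteq> V"
    using char unfolding countable_character_in_def by metis
  \<comment> \<open>Intersecting the first n + 1 base sets forces term n of a sequence into all of
    them, as the accumulation lemma demands.\<close>
  define U' where "U' n = x <# (\<Inter>i\<le>n. U i)" for n
  have inter: "(\<Inter>i\<le>n. U i) \<subseteq> carrier G" for n
    using U(1) openin_subset_carrier by blast
  show "\<exists>U. (\<forall>n. openin T (U n) \<and> x \<in> U n) \<and>
      (\<forall>s. (\<forall>n. s n \<in> U n) \<longrightarrow> (\<exists>y. accumulation_point_of_seq T s y))"
  proof (intro exI [of _ U'] conjI allI impI)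
    fix n
    show "openin T (U' n)"
      unfolding U'_def using U(1) x by (intro openin_l_coset openin_INT2) auto
    show "x \<in> U' n"
      unfolding U'_def using U(2) one x inter by (auto simp: mem_l_coset_iff)
  next
    fix s :: "nat \<Rightarrow> 'a" assume "\<forall>n. s n \<in> U' n"
    then have s: "s n \<in> carrier G" "inv x \<otimes> s n \<in> (\<Inter>i\<le>n. U i)" for n
      using x inter by (auto simp: U'_def mem_l_coset_iff)
    have "\<exists>y. accumulation_point_of_seq T (\<lambda>n. inv x \<otimes> s n) y"
    proof (rule accumulation_point_near_countably_compactin [OF cc base])
      show "inv x \<otimes> s n \<in> topspace T" for n
        using s(1) x by (simp add: topspace_eq_carrier)
      show "inv x \<otimes> s n \<in> U i" if "i \<le> n" for i n
        using s(2) that by blast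
    qed
    then show "\<exists>y. accumulation_point_of_seq T s y"
      using accumulation_point_translate x s(1) by blast
  qed
qed

end

section \<open>The quotient by the intersection of a neighbourhood sequence\<close>

context normal_nbhd_sequence
begin

definition core :: "'a set" where
  "core = (\<Inter>n. W n)"

lemma W_subset_carrier: "W n \<subseteq> carrier G"
  using open_W by (rule openin_subset_carrier)

lemma core_subset_W: "core \<subseteq> W n"
  by (auto simp: core_def)

lemma core_normal: "core \<lhd> G"
proof (rule normal_invI)
  have div: "a \<otimes> inv b \<in> core" if "a \<in> core" "b \<in> core" for a b
    unfolding core_def
  proof
    fix n
    show "a \<otimes> inv b \<in> W n"
      using div_W [of n] that by (auto simp: core_def)
  qed
  have one: "\<one> \<in> core"
    by (simp add: core_def one_W)
  have coreG: "core \<subseteq> carrier G"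
    using core_subset_W W_subset_carrier by blast
  have inv: "inv a \<in> core" if "a \<in> core" for a
    using div [OF one that] coreG that by auto
  show "subgroup core G"
  proof
    fix a b assume "a \<in> core" "b \<in> core"
    then show "a \<otimes> b \<in> core"
      using div [OF _ inv, of a b] coreG by auto
  qed (use coreG one inv in auto)
  fix x h assume "x \<in> carrier G" "h \<in> core"
  then show "x \<otimes> h \<otimes> inv x \<in> core"
    using conj_W [of x] unfolding core_def by (metis INT_I INT_E UNIV_I)
qed

lemma core_subgroup: "subgroup core G"
  using core_normal by (rule normal_imp_subgroup)

text \<open>If z is in the closure, its neighbourhood \<open>z <# W m\<close> meets
  \<open>x <# W m\<close> in some y. Dividing \<open>inv x \<otimes> y\<close> by
  \<open>inv z \<otimes> y\<close> leaves \<open>inv x \<otimes> z\<close>, which therefore lies in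
  \<open>W n\<close>.\<close>

lemma closure_of_l_coset_W:
  assumes x: "x \<in> carrier G"
  shows "\<exists>m. T closure_of (x <# W m) \<subseteq> x <# W n"
proof -
  obtain m where m: "\<forall>a\<in>W m. \<forall>b\<in>W m. a \<otimes> inv b \<in> W n"
    using div_W by blast
  have "z \<in> x <# W n" if zm: "z \<in> T closure_of (x <# W m)" for z
  proof -
    have z: "z \<in> carrier G"
      using zm unfolding in_closure_of topspace_eq_carrier by blast
    have "openin T (z <# W m)" "z \<in> z <# W m"
      using z by (simp_all add: openin_l_coset open_W mem_l_coset_iff W_subset_carrier one_W)
    then obtain y where "y \<in> x <# W m" "y \<in> z <# W m"
      using zm unfolding in_closure_of by metis
    then have y: "y \<in> carrier G" "inv x \<otimes> y \<in> W m" "inv z \<otimes> y \<in> W m"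
      using x z by (simp_all add: mem_l_coset_iff W_subset_carrier)
    have "(inv x \<otimes> y) \<otimes> inv (inv z \<otimes> y) \<in> W n"
      using m y by blast
    moreover have "(inv x \<otimes> y) \<otimes> inv (inv z \<otimes> y) = inv x \<otimes> (y \<otimes> inv y) \<otimes> z"
      using x y(1) z by (simp only: inv_mult_group inv_inv inv_closed m_assoc m_closed)
    ultimately show ?thesis
      using x y(1) z by (simp add: mem_l_coset_iff W_subset_carrier)
  qed
  then show ?thesis
    by blast
qed

text \<open>As W decreases, s is eventually in each \<open>W m\<close>, so y lies in every closure
  of a \<open>W m\<close>, and each \<open>W n\<close> contains such a closure.\<close>

lemma accumulation_point_in_core:
  assumes s: "\<And>n. s n \<in> W n" and y: "accumulation_point_of_seq T s y"
  shows "y \<in> core"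
  unfolding core_def
proof
  fix n
  have "\<one> <# W k = W k" for k
    using W_subset_carrier by (rule lcos_mult_one)
  then obtain m where m: "T closure_of W m \<subseteq> W n"
    using closure_of_l_coset_W [of \<one> n] by auto
  have "y \<in> T closure_of W m"
    unfolding in_closure_of
  proof (intro conjI allI impI)
    show "y \<in> topspace T"
      using y by (simp add: accumulation_point_of_seq_def)
    fix V assume "y \<in> V \<and> openin T V"
    then have "infinite {k. s k \<in> V}"
      using y by (simp add: accumulation_point_of_seq_def)
    then obtain k where "m \<le> k" "s k \<in> V"
      unfolding infinite_nat_iff_unbounded_le by blast
    then show "\<exists>y. y \<in> W m \<and> y \<in> V"
      using s decseqD [OF decseq_W] by blast
  qed
  then show "y \<in> W n"
    using m by blast
qed

end

text \<open>The added condition is the q-point property at the identity; it is inherited by every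
  sequence that refines a witnessing one.\<close>

locale q_nbhd_sequence = normal_nbhd_sequence +
  assumes accumulation_W: "(\<And>n. s n \<in> W n) \<Longrightarrow> \<exists>y. accumulation_point_of_seq T s y"
begin

text \<open>Otherwise choose \<open>s n\<close> in \<open>W n\<close> outside V. The sequence
  accumulates at a point of the core, hence inside V, although it never enters V.\<close>

lemma W_base_at_core:
  assumes V: "openin T V" "core \<subseteq> V"
  shows "\<exists>n. W n \<subseteq> V"
proof (rule ccontr)
  assume "\<not> ?thesis"
  then have "\<forall>n. \<exists>x. x \<in> W n \<and> x \<notin> V"
    by blast
  then obtain s where s: "\<And>n. s n \<in> W n" "\<And>n. s n \<notin> V"
    by metis
  obtain y where "accumulation_point_of_seq T s y"
    using accumulation_W [OF s(1)] by blast
  moreover from this have "y \<in> V"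
    using accumulation_point_in_core [OF s(1)] V(2) by blast
  ultimately have "infinite {n. s n \<in> V}"
    using V(1) by (simp add: accumulation_point_of_seq_def)
  then show False
    using s(2) by simp
qed

lemma l_coset_W_base:
  assumes x: "x \<in> carrier G" and V: "openin T V" "x <# core \<subseteq> V"
  shows "\<exists>n. x <# W n \<subseteq> V"
proof -
  have VG: "V \<subseteq> carrier G"
    using V(1) by (rule openin_subset_carrier)
  have coreG: "core \<subseteq> carrier G"
    using core_subgroup by (rule subgroup.subset)
  have "core \<subseteq> inv x <# V"
  proof
    fix h assume h: "h \<in> core"
    then have "x \<otimes> h \<in> V"
      using V(2) unfolding l_coset_def by blast
    then show "h \<in> inv x <# V"
      using h coreG x VG by (auto simp: mem_l_coset_iff)
  qed
  then obtain n where n: "W n \<subseteq> inv x <# V"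
    using W_base_at_core [of "inv x <# V"] V(1) x openin_l_coset by auto
  have "y \<in> V" if "y \<in> x <# W n" for y
  proof -
    have y: "y \<in> carrier G" "inv x \<otimes> y \<in> inv x <# V"
      using that n x by (auto simp: mem_l_coset_iff W_subset_carrier)
    then have "x \<otimes> (inv x \<otimes> y) \<in> V"
      using x VG by (simp add: mem_l_coset_iff)
    then show ?thesis
      using x y(1) by (simp add: m_assoc [symmetric])
  qed
  then show ?thesis
    by blast
qed

lemma countable_character_in_core: "countable_character_in T core"
  unfolding countable_character_in_def
  using open_W core_subset_W W_base_at_core by blast

text \<open>All cosets are treated, not only the core itself, because they are the fibres of the
  quotient map.\<close>

lemma countably_compactin_l_coset_core:
  assumes x: "x \<in> carrier G"
  shows "countably_compactin T (x <# core)"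
proof (rule countably_compactin_if_accumulation_points)
  have coreG: "core \<subseteq> carrier G"
    using core_subgroup by (rule subgroup.subset)
  then show "x <# core \<subseteq> topspace T"
    using x by (simp add: topspace_eq_carrier l_coset_subset_G)
  fix s :: "nat \<Rightarrow> 'a" assume "\<And>n. s n \<in> x <# core"
  then have s: "\<And>n. s n \<in> carrier G" "\<And>n. inv x \<otimes> s n \<in> core"
    using x coreG by (simp_all add: mem_l_coset_iff)
  have sW: "\<And>n. inv x \<otimes> s n \<in> W n"
    using s(2) core_subset_W by blast
  obtain y where y: "accumulation_point_of_seq T (\<lambda>n. inv x \<otimes> s n) y"
    using accumulation_W [OF sW] by blast
  have "y \<in> core"
    using y accumulation_point_in_core [OF sW] by blast
  then have "x \<otimes> y \<in> x <# core"
    unfolding l_coset_def by blast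
  moreover have "accumulation_point_of_seq T s (x \<otimes> y)"
    using x s(1) y by (rule accumulation_point_translate)
  ultimately show "\<exists>y\<in>x <# core. accumulation_point_of_seq T s y"
    by blast
qed

lemma countably_compactin_core: "countably_compactin T core"
  using countably_compactin_l_coset_core [of \<one>] lcos_mult_one
    subgroup.subset [OF core_subgroup] by simp

section \<open>The quotient by the core: closedness of the map, regularity and countable
  base\<close>

abbreviation p :: "'a \<Rightarrow> 'a set" where
  "p \<equiv> coset_map G core"

abbreviation Q :: "'a set topology" where
  "Q \<equiv> coset_space G T core"

lemma topspace_Q: "topspace Q = p ` carrier G"
  by (simp add: coset_space_def topspace_eq_carrier)

lemma p_eq_iff:
  "x \<in> carrier G \<Longrightarrow> y \<in> carrier G \<Longrightarrow> p x = p y \<longleftrightarrow> inv x \<otimes> y \<in> core"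
  by (rule coset_map_eq_iff [OF core_subgroup])

lemma fibre_p: 
  assumes "x \<in> carrier G"
  shows "{z \<in> topspace T. p z = p x} = x <# core"
proof -
  have "z \<in> carrier G \<Longrightarrow> p z = p x \<longleftrightarrow> inv x \<otimes> z \<in> core" for z
    using p_eq_iff [OF assms] by metis
  then show ?thesis
    using assms subgroup.subset [OF core_subgroup]
    by (intro Set.set_eqI) (simp add: mem_l_coset_iff topspace_eq_carrier cong: conj_cong)
qed

text \<open>If the coset of x misses F, so does some \<open>x <# W n\<close>. With m chosen for
  division into \<open>W n\<close>, a point z of \<open>x <# W m\<close> sharing a coset with some f
  in F would put f into \<open>x <# W n\<close>. Hence the points whose coset misses F form an open
  set.\<close>

lemma closed_map_p: "closed_map T Q p"
  unfolding closed_map_def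
proof (intro allI impI)
  fix F assume F: "closedin T F"
  have FG: "F \<subseteq> carrier G"
    using F closedin_subset topspace_eq_carrier by metis
  let ?D = "{x \<in> topspace T. p x \<in> topspace Q - p ` F}"
  have "\<exists>N. openin T N \<and> x \<in> N \<and> N \<subseteq> ?D" if "x \<in> ?D" for x
  proof -
    have x: "x \<in> carrier G" "p x \<notin> p ` F"
      using that by (auto simp: topspace_eq_carrier)
    have "x <# core \<subseteq> topspace T - F"
    proof -
      have "x <# core \<subseteq> {z \<in> topspace T. p z = p x}"
        using fibre_p [OF x(1)] by simp
      then show ?thesis
        using x(2) by (auto dest: sym)
    qed
    then obtain n where n: "x <# W n \<subseteq> topspace T - F"
      using l_coset_W_base [OF x(1), of "topspace T - F"] F by blast
    obtain m where m: "\<forall>a\<in>W m. \<forall>b\<in>W m. a \<otimes> inv b \<in> W n"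
      using div_W by blast
    have "z \<in> ?D" if "z \<in> x <# W m" for z
    proof -
      have z: "z \<in> carrier G" "inv x \<otimes> z \<in> W m"
        using that x(1) by (simp_all add: mem_l_coset_iff W_subset_carrier)
      have "p z \<noteq> p f" if f: "f \<in> F" for f
      proof
        assume "p z = p f"
        then have "inv f \<otimes> z \<in> core"
          using p_eq_iff [of f z] f FG z(1) by auto
        then have "inv f \<otimes> z \<in> W m"
          using core_subset_W by blast
        then have "(inv x \<otimes> z) \<otimes> inv (inv f \<otimes> z) \<in> W n"
          using m z(2) by blast
        moreover have "f \<in> carrier G"
          using f FG by blast
        moreover from this have
          "(inv x \<otimes> z) \<otimes> inv (inv f \<otimes> z) = inv x \<otimes> (z \<otimes> inv z) \<otimes> f"
          using x(1) z(1) by (simp only: inv_mult_group inv_inv inv_closed m_assoc m_closed)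
        ultimately have "f \<in> x <# W n"
          using x(1) z(1) by (simp add: mem_l_coset_iff W_subset_carrier)
        then show False
          using n f by blast
      qed
      then show ?thesis
        using z(1) by (auto simp: topspace_Q topspace_eq_carrier)
    qed
    moreover have "openin T (x <# W m)" "x \<in> x <# W m"
      using x(1) by (simp_all add: openin_l_coset open_W mem_l_coset_iff W_subset_carrier one_W)
    ultimately show ?thesis
      by blast
  qed
  then have "openin T ?D"
    by (subst openin_subopen) blast
  then show "closedin Q (p ` F)"
    using FG unfolding closedin_def coset_space_def openin_quotient_topology
    by (auto simp: topspace_eq_carrier)
qed

lemma quasi_perfect_map_p: "quasi_perfect_map T Q p"
  unfolding quasi_perfect_map_def
  using continuous_map_coset_map closed_map_p countably_compactin_l_coset_core fibre_p
  by (auto simp: topspace_Q)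

lemma p_l_coset_W_base:
  assumes V: "openin Q V" "p x \<in> V" and x: "x \<in> carrier G"
  shows "\<exists>n. x <# W n \<subseteq> {z \<in> topspace T. p z \<in> V}"
proof (rule l_coset_W_base [OF x])
  show "openin T {z \<in> topspace T. p z \<in> V}"
    using continuous_map_coset_map V(1) by (rule openin_continuous_map_preimage)
  show "x <# core \<subseteq> {z \<in> topspace T. p z \<in> V}"
    using V(2) unfolding fibre_p [OF x, symmetric] by auto
qed

lemma openin_p_l_coset_W: "x \<in> carrier G \<Longrightarrow> openin Q (p ` (x <# W n))"
  using open_map_coset_map [OF core_subgroup] openin_l_coset [OF open_W]
  unfolding open_map_def by blast

lemma mem_l_coset_W_self: "x \<in> carrier G \<Longrightarrow> x \<in> x <# W n"
  by (simp add: mem_l_coset_iff W_subset_carrier one_W)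

text \<open>The quotient map is both open and closed, so the image of \<open>x <# W m\<close> is
  open and the image of its closure is a closed neighbourhood of y, which fits into V for suitable
  m.\<close>

lemma regular_space_Q: "regular_space Q"
  unfolding neighbourhood_base_of_closedin [symmetric] neighbourhood_base_of
proof (intro allI impI)
  fix V y assume V: "openin Q V \<and> y \<in> V"
  then obtain x where x: "x \<in> carrier G" "y = p x"
    using openin_subset topspace_Q by blast
  obtain n where n: "x <# W n \<subseteq> {z \<in> topspace T. p z \<in> V}"
    using p_l_coset_W_base V x by blast
  obtain m where m: "T closure_of (x <# W m) \<subseteq> x <# W n"
    using closure_of_l_coset_W x(1) by blast
  define U where "U = p ` (x <# W m)"
  define C where "C = p ` (T closure_of (x <# W m))"
  have "openin Q U"
    unfolding U_def using x(1) by (rule openin_p_l_coset_W)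
  moreover have "closedin Q C"
    using closed_map_p unfolding closed_map_def C_def by simp
  moreover have "y \<in> U"
    unfolding U_def x(2) using mem_l_coset_W_self [OF x(1)] by (rule imageI)
  moreover have "U \<subseteq> C"
    unfolding U_def C_def using openin_subset [OF openin_l_coset [OF open_W x(1)]]
    by (intro image_mono closure_of_subset)
  moreover have "C \<subseteq> V"
    unfolding C_def using m n by blast
  ultimately show "\<exists>U C. openin Q U \<and> closedin Q C \<and> y \<in> U \<and> U \<subseteq> C \<and> C \<subseteq> V"
    by blast
qed

text \<open>Narrowness gives countable sets \<open>A n\<close> with A n W n = G; the images of the
  translates of \<open>W n\<close> by points of \<open>A n\<close> form a base.\<close>

lemma second_countable_Q:
  assumes narrow: "omega_narrow G T"
  shows "second_countable Q"
proof -
  have "\<exists>A. countable A \<and> A \<subseteq> carrier G \<and> A <#> W n = carrier G" for n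
    using narrow open_W one_W unfolding omega_narrow_def by blast
  then obtain A where A: "\<And>n. countable (A n)" "\<And>n. A n \<subseteq> carrier G"
      "\<And>n. A n <#> W n = carrier G"
    by metis
  define B where "B = (\<Union>n. (\<lambda>a. p ` (a <# W n)) ` A n)"
  show ?thesis
    unfolding second_countable_def
  proof (intro exI [of _ B] conjI ballI allI impI)
    show "countable B"
      unfolding B_def using A(1) by blast
    show "openin Q V" if "V \<in> B" for V
      using that A(2) openin_p_l_coset_W unfolding B_def by blast
    fix V y assume V: "openin Q V \<and> y \<in> V"
    then obtain x where x: "x \<in> carrier G" "y = p x"
      using openin_subset topspace_Q by blast
    obtain n where n: "x <# W n \<subseteq> {z \<in> topspace T. p z \<in> V}"
      using p_l_coset_W_base V x by blast
    \<comment> \<open>Two division steps are needed: the first puts inverses of elements of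
      \<open>W m\<close> into \<open>W k\<close>, the second then puts the product of w inverse and
      \<open>inv a \<otimes> z\<close> into \<open>W n\<close>.\<close>
    obtain k where k: "\<forall>a\<in>W k. \<forall>b\<in>W k. a \<otimes> inv b \<in> W n"
      using div_W by blast
    obtain m where m: "\<forall>a\<in>W m. \<forall>b\<in>W m. a \<otimes> inv b \<in> W k"
      using div_W by blast
    obtain a w where aw: "a \<in> A m" "w \<in> W m" "x = a \<otimes> w"
      using A(3) [of m] x(1) unfolding set_mult_def by blast
    have G: "a \<in> carrier G" "w \<in> carrier G"
      using aw A(2) W_subset_carrier by blast+
    have "a <# W m \<subseteq> x <# W n"
    proof
      fix z assume "z \<in> a <# W m"
      then have z: "z \<in> carrier G" "inv a \<otimes> z \<in> W m"
        using G(1) by (simp_all add: mem_l_coset_iff W_subset_carrier)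
      have "\<one> \<otimes> inv w \<in> W k" "\<one> \<otimes> inv (inv a \<otimes> z) \<in> W k"
        using m z(2) aw(2) one_W by blast+
      then have "(\<one> \<otimes> inv w) \<otimes> inv (\<one> \<otimes> inv (inv a \<otimes> z)) \<in> W n"
        using k by blast
      then have "inv x \<otimes> z \<in> W n"
        using G z(1) by (simp add: aw(3) inv_mult_group m_assoc)
      then show "z \<in> x <# W n"
        using x(1) z(1) by (simp add: mem_l_coset_iff W_subset_carrier)
    qed
    then have "p ` (a <# W m) \<subseteq> V"
      using n by blast
    moreover have "x \<in> a <# W m"
      using aw unfolding l_coset_def by blast
    moreover have "p ` (a <# W m) \<in> B"
      using aw(1) by (auto simp: B_def)
    ultimately show "\<exists>V'\<in>B. y \<in> V' \<and> V' \<subseteq> V"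
      using x(2) by blast
  qed
qed

lemma t1_space_Q:
  assumes "t1_space T"
  shows "t1_space Q"
  unfolding t1_space_closedin_singleton
proof
  fix y assume "y \<in> topspace Q"
  then have "y \<in> p ` topspace T"
    by (simp add: topspace_Q topspace_eq_carrier)
  then obtain x where x: "x \<in> topspace T" "y = p x"
    by blast
  then have "closedin T {x}"
    using assms by (simp add: t1_space_closedin_singleton)
  then have "closedin Q (p ` {x})"
    using closed_map_p unfolding closed_map_def by blast
  then show "closedin Q {y}"
    using x(2) by simp
qed

end

section \<open>Both implications of the equivalence\<close>

theorem corollary2p7:
  fixes G :: "('a, 'b) monoid_scheme" and T :: "'a topology"
  assumes "topological_group G T" and "Hausdorff_space T"
  shows "omega_narrow G T \<and> q_space T \<longleftrightarrow>
    (\<forall>O'. openin T O' \<and> \<one>\<^bsub>G\<^esub> \<in> O' \<longrightarrow>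
      (\<exists>H. H \<lhd> G \<and> countably_compactin T H \<and> countable_character_in T H \<and> H \<subseteq> O' \<and>
           quasi_perfect_map T (coset_space G T H) (coset_map G H) \<and>
           separable_space (coset_space G T H) \<and> metrizable_space (coset_space G T H)))"
    (is "?L \<longleftrightarrow> ?R")
proof
  interpret topological_group G T by fact
  show ?R if L: ?L
  proof (intro allI impI)
    fix O' assume O': "openin T O' \<and> \<one>\<^bsub>G\<^esub> \<in> O'"
    have "q_point T \<one>\<^bsub>G\<^esub>"
      using L by (simp add: q_space_def topspace_eq_carrier)
    then obtain U :: "nat \<Rightarrow> 'a set"
      where U: "\<And>n. openin T (U n)" "\<And>n. \<one>\<^bsub>G\<^esub> \<in> U n"
        and acc: "\<And>s. \<forall>n. s n \<in> U n \<Longrightarrow> \<exists>y. accumulation_point_of_seq T s y"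
      unfolding q_point_def by metis
    \<comment> \<open>Refining \<open>U n\<close> keeps the accumulation property, and intersecting
      with \<open>O'\<close> places the core inside \<open>O'\<close>.\<close>
    obtain W where W: "normal_nbhd_sequence G T W" "\<And>n. W n \<subseteq> U n \<inter> O'"
    proof (rule omega_narrow_imp_normal_nbhd_sequence [of "\<lambda>n. U n \<inter> O'"])
      show "omega_narrow G T"
        using L by blast
      show "openin T (U n \<inter> O')" "\<one>\<^bsub>G\<^esub> \<in> U n \<inter> O'" for n :: nat
        using U O' by auto
    qed (rule that)
    interpret W: normal_nbhd_sequence G T W by fact
    interpret W: q_nbhd_sequence G T W
    proof
      fix s :: "nat \<Rightarrow> 'a" assume "\<And>n. s n \<in> W n"
      then show "\<exists>y. accumulation_point_of_seq T s y"
        using acc W(2) by blast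
    qed
    have second: "second_countable W.Q"
      using L W.second_countable_Q by blast
    have "metrizable_space W.Q"
      using W.regular_space_Q second
      by (rule regular_second_countable_imp_metrizable_space)
        (simp add: W.t1_space_Q Hausdorff_imp_t1_space assms(2))
    moreover have "W.core \<subseteq> O'"
      using W.core_subset_W W(2) by blast
    ultimately show "\<exists>H. H \<lhd> G \<and> countably_compactin T H \<and> countable_character_in T H \<and> H \<subseteq> O' \<and>
           quasi_perfect_map T (coset_space G T H) (coset_map G H) \<and>
           separable_space (coset_space G T H) \<and> metrizable_space (coset_space G T H)"
      using W.core_normal W.countably_compactin_core W.countable_character_in_core
        W.quasi_perfect_map_p second_countable_imp_separable_space [OF second]
      by blast
  qed
  show ?L if R: ?R
  proof
    show "omega_narrow G T"
      unfolding omega_narrow_def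
    proof (intro allI impI)
      fix V assume V: "openin T V \<and> \<one>\<^bsub>G\<^esub> \<in> V"
      then obtain H where H: "H \<lhd> G" "H \<subseteq> V"
        "quasi_perfect_map T (coset_space G T H) (coset_map G H)"
        "separable_space (coset_space G T H)"
        using R by blast
      then show "\<exists>A. countable A \<and> A \<subseteq> carrier G \<and> A <#>\<^bsub>G\<^esub> V = carrier G"
        using omega_narrow_at_if_separable_quotient [of H V] V
        unfolding quasi_perfect_map_def by metis
    qed
    \<comment> \<open>The whole group is taken as the neighbourhood, since any one such H yields the
      q-space property.\<close>
    obtain H where H: "H \<lhd> G" "countably_compactin T H" "countable_character_in T H"
      using R [rule_format, of "carrier G"] openin_topspace [of T] one_closed
      unfolding topspace_eq_carrier by blast
    show "q_space T"
      using H(2,3) subgroup.one_closed [OF normal_imp_subgroup [OF H(1)]]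
      by (rule q_space_if_countably_compact_countable_character)
  qed
qed

end
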